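(* Let $D\ge 2$ be an integer and let $T$ be the infinite rooted complete $D$-ary tree (the rooted tree in which each vertex has exactly $D$ children), with graph distance $d$. Let $(A_n)_{n\in\mathbb{N}}$ be a sequence of finite non-empty subsets of (vertices of) $T$ such that $\lim_{n\to\infty}|A_n|=\infty$. Then for all $k\in\mathbb{N}$, $$|A_n|^{-2}\sum_{u,v\in A_n}\mathbf{1}_{\{d(u,v)\le k\}}\longrightarrow 0\quad\text{as } n\to\infty .$$
   Context: $|A|$ denotes the cardinality of $A$. The displayed quantity equals $\mathbb{P}(d(U_n,V_n)\le k)$ for $U_n,V_n$ independent and uniformly distributed on $A_n$. *)

theory Defs
  imports Complex_Main "HOL-Library.Extended_Nat"
begin

text \<open>The complete \<open>D\<close>-ary tree in Ulam--Harris coordinates: vertices are the finite words over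
  \<open>{0, \<dots>, D - 1}\<close>, the root is the empty word, and the children of \<open>w\<close> are the words \<open>w @ [i]\<close>
  with \<open>i < D\<close>.\<close>

definition tree_verts :: "nat \<Rightarrow> nat list set" where
  "tree_verts D = lists {..<D}"

definition tree_child :: "nat \<Rightarrow> (nat list \<times> nat list) set" where
  "tree_child D = {(w, w @ [i]) | w i. w \<in> tree_verts D \<and> i < D}"

definition tree_edges :: "nat \<Rightarrow> (nat list \<times> nat list) set" where
  "tree_edges D = tree_child D \<union> (tree_child D)\<inverse>"

text \<open>Graph distance is the length of a shortest walk: \<open>E ^^ n\<close> relates the endpoints of walks with
  exactly \<open>n\<close> edges. The value is \<open>\<infinity>\<close> if there is no walk.\<close>

definition graph_dist :: "('a \<times> 'a) set \<Rightarrow> 'a \<Rightarrow> 'a \<Rightarrow> enat" where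
  "graph_dist E u v = (INF n \<in> {n. (u, v) \<in> E ^^ n}. enat n)"

definition tree_dist :: "nat \<Rightarrow> nat list \<Rightarrow> nat list \<Rightarrow> enat" where
  "tree_dist D = graph_dist (tree_edges D)"

end

theory Submission
  imports Defs
begin

text \<open>Every vertex of the tree has degree at most \<open>D + 1\<close>, so the number of vertices within distance
  \<open>k\<close> of \<open>u\<close> is bounded by some \<open>C\<close> that does not depend on \<open>u\<close>. Hence the double sum is at most
  \<open>C\<close> times \<open>|A\<^sub>n|\<close>, and the normalised quantity is at most \<open>C / |A\<^sub>n|\<close>.\<close>

text \<open>An infimum lies strictly below a bound iff some member does; hence the detour through
  \<open>< enat (Suc k)\<close>. It also covers an empty set of walk lengths, whose infimum is
  \<open>\<infinity>\<close>.\<close>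

lemma graph_dist_le_iff:
  "graph_dist E u v \<le> enat k \<longleftrightarrow> (\<exists>j\<le>k. (u, v) \<in> E ^^ j)"
proof -
  have "graph_dist E u v \<le> enat k \<longleftrightarrow> graph_dist E u v < enat (Suc k)"
    by (cases "graph_dist E u v") auto
  also have "\<dots> \<longleftrightarrow> (\<exists>j\<le>k. (u, v) \<in> E ^^ j)"
    by (auto simp: graph_dist_def INF_less_iff less_Suc_eq_le)
  finally show ?thesis .
qed

text \<open>Induction on the length: a walk with \<open>Suc n\<close> edges extends one with
  \<open>n\<close> edges by one of at most \<open>d\<close> successors of its endpoint.\<close>

lemma card_relpow_Image_le:
  fixes E :: "('a \<times> 'a) set"
  assumes "\<And>u. finite (E `` {u})" and "\<And>u. card (E `` {u}) \<le> d"
  shows "finite ((E ^^ n) `` {u}) \<and> card ((E ^^ n) `` {u}) \<le> d ^ n"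
proof (induction n)
  case 0
  have "(E ^^ 0) `` {u} = {u}" by auto
  then show ?case by simp
next
  case (Suc n)
  let ?S = "(E ^^ n) `` {u}"
  have eq: "(E ^^ Suc n) `` {u} = (\<Union>w\<in>?S. E `` {w})"
    by auto
  have "card (\<Union>w\<in>?S. E `` {w}) \<le> (\<Sum>w\<in>?S. card (E `` {w}))"
    using Suc by (intro card_UN_le) simp
  also have "\<dots> \<le> card ?S * d"
    using sum_bounded_above[of ?S "\<lambda>w. card (E `` {w})" d] assms(2) by simp
  also have "\<dots> \<le> d ^ Suc n"
    using Suc by (simp add: mult.commute)
  finally show ?case
    unfolding eq using Suc assms(1) by blast
qed

text \<open>The ball is the union over \<open>j \<le> k\<close> of the sets reached by exactly
  \<open>j\<close> steps; these may overlap, so the count is a union bound.\<close>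

lemma card_graph_ball_le:
  assumes "\<And>u. finite (E `` {u})" and "\<And>u. card (E `` {u}) \<le> d"
  shows "finite {v. graph_dist E u v \<le> enat k}"
    and "card {v. graph_dist E u v \<le> enat k} \<le> (\<Sum>j\<le>k. d ^ j)"
proof -
  note relpow = card_relpow_Image_le[OF assms]
  have eq: "{v. graph_dist E u v \<le> enat k} = (\<Union>j\<le>k. (E ^^ j) `` {u})"
    by (auto simp: graph_dist_le_iff)
  show "finite {v. graph_dist E u v \<le> enat k}"
    unfolding eq using relpow by blast
  have "card (\<Union>j\<le>k. (E ^^ j) `` {u}) \<le> (\<Sum>j\<le>k. card ((E ^^ j) `` {u}))"
    by (intro card_UN_le) simp
  also have "\<dots> \<le> (\<Sum>j\<le>k. d ^ j)"
    using relpow by (intro sum_mono) blast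
  finally show "card {v. graph_dist E u v \<le> enat k} \<le> (\<Sum>j\<le>k. d ^ j)"
    unfolding eq .
qed

lemma tree_degree_le:
  shows "finite (tree_edges D `` {u})" and "card (tree_edges D `` {u}) \<le> Suc D"
proof -
  \<comment> \<open>One possible parent and \<open>D\<close> possible children. As
    \<open>butlast [] = []\<close>, the root gets a spurious element, harmless for an upper
    bound.\<close>
  let ?N = "insert (butlast u) ((\<lambda>i. u @ [i]) ` {..<D})"
  have sub: "tree_edges D `` {u} \<subseteq> ?N"
    by (auto simp: tree_edges_def tree_child_def)
  show "finite (tree_edges D `` {u})"
    using sub by (rule finite_subset) simp
  have "card (tree_edges D `` {u}) \<le> card ?N"
    using sub by (intro card_mono) auto
  also have "\<dots> \<le> Suc (card ((\<lambda>i. u @ [i]) ` {..<D}))"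
    by (rule card_insert_le_m1) auto
  also have "\<dots> \<le> Suc D"
    using card_image_le[of "{..<D}" "\<lambda>i. u @ [i]"] by simp
  finally show "card (tree_edges D `` {u}) \<le> Suc D" .
qed

theorem lemma3p1:
  fixes D :: nat and A :: "nat \<Rightarrow> nat list set" and k :: nat
  assumes "D \<ge> 2"
    and "\<And>n. A n \<subseteq> tree_verts D"
    and "\<And>n. finite (A n)"
    and "\<And>n. A n \<noteq> {}"
    and "filterlim (\<lambda>n. card (A n)) at_top sequentially"
  shows "(\<lambda>n. real (card (A n)) powi (-2) *
            (\<Sum>u\<in>A n. \<Sum>v\<in>A n. of_bool (tree_dist D u v \<le> enat k))) \<longlonglongrightarrow> 0"
proof -
  define C where "C = (\<Sum>j\<le>k. Suc D ^ j)"
  note ball = card_graph_ball_le[where k = k, OF tree_degree_le[of D], folded tree_dist_def C_def]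
  have bound: "real (card (A n)) powi (-2) *
      (\<Sum>u\<in>A n. \<Sum>v\<in>A n. of_bool (tree_dist D u v \<le> enat k)) \<le> real C / real (card (A n))"
    (is "_ * ?S \<le> _") for n
  proof -
    have pos: "real (card (A n)) > 0"
      using assms(3,4) by (simp add: card_gt_0_iff)
    have "(\<Sum>v\<in>A n. of_bool (tree_dist D u v \<le> enat k)) \<le> real C" for u
    proof -
      \<comment> \<open>The inner sum counts the points of \<open>A n\<close> in the ball of radius
        \<open>k\<close> around \<open>u\<close>.\<close>
      have "card (A n \<inter> {v. tree_dist D u v \<le> enat k}) \<le> card {v. tree_dist D u v \<le> enat k}"
        using ball(1) by (intro card_mono) auto
      also have "\<dots> \<le> C" by (rule ball(2))
      finally show ?thesis
        using assms(3) by simp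
    qed
    then have "?S \<le> real (card (A n)) * real C"
      by (intro sum_bounded_above)
    \<comment> \<open>One factor \<open>card (A n)\<close> cancels against the square;
      \<open>pos\<close> excludes division by zero.\<close>
    then show ?thesis
      using pos by (simp add: power_int_minus field_simps power2_eq_square)
  qed
  have "(\<lambda>n. real C / real (card (A n))) \<longlonglongrightarrow> 0"
    using assms(5) by (intro real_tendsto_divide_at_top[OF tendsto_const]
      filterlim_compose[OF filterlim_real_sequentially])
  then show ?thesis
    \<comment> \<open>\<open>rotated 3\<close> puts the limit of the upper bound first, to match the
      chained fact; the lower bound is \<open>0\<close>.\<close>
    by (rule tendsto_sandwich[rotated 3, where f = "\<lambda>_. 0"])
      (auto intro!: always_eventually bound mult_nonneg_nonneg sum_nonneg)
qed

end
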